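(* Let $q$ be an odd prime power and let $n=2t\ge 6$ be even. Let $k$ be a positive integer with $\gcd(n,k)=1$ such that $\psi_n^{(k)}(x)$ is scattered. Then the linear set $L_{\psi_n^{(k)}}$ of $\mathrm{PG}(1,q^n)$ is not of pseudoregulus type.
   Context: For $n=2t$, $t\ge3$, let $\psi_n(x)=\frac12\bigl(x^{q}+x^{q^{t-1}}-x^{q^{t+1}}+x^{q^{2t-1}}\bigr)\in\mathbb{F}_{q^n}[x]$, regarded as an $\mathbb{F}_q$-linear map of $\mathbb{F}_{q^n}$, and let $\psi_n^{(k)}$ be its $k$-fold composition with itself. A $q$-polynomial (polynomial of the form $\sum_i c_ix^{q^i}$) $f\in\mathbb{F}_{q^n}[x]$ is scattered if $f(x)+mx$ has at most $q$ roots in $\mathbb{F}_{q^n}$ for every $m\in\mathbb{F}_{q^n}$. For a $q$-polynomial $f$ over $\mathbb{F}_{q^n}$, $L_f=\{\langle (x,f(x))\rangle_{\mathbb{F}_{q^n}}: x\in\mathbb{F}_{q^n}^*\}$ is a set of points of $\mathrm{PG}(1,q^n)$. Two linear sets of $\mathrm{PG}(1,q^n)$ are $\mathrm{P\Gamma L}$-equivalent if some element of $\mathrm{P\Gamma L}(2,q^n)$ maps one onto the other. A linear set of $\mathrm{PG}(1,q^n)$ is of pseudoregulus type if it is $\mathrm{P\Gamma L}$-equivalent to $L_f$ with $f(x)=x^{q^s}$ for some $1\le s\le n-1$ with $\gcd(s,n)=1$. *)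

theory Defs
  imports
    "HOL-Analysis.Cartesian_Space"
    "HOL-Computational_Algebra.Polynomial"
    "HOL-Number_Theory.Prime_Powers"
begin

text \<open>
  The field of order \<open>q ^ n\<close> is a type \<open>'a :: {field, finite}\<close> with \<open>CARD('a) = q ^ n\<close>; it determines
  neither \<open>q\<close> nor \<open>n\<close>, so these are passed explicitly.
\<close>

definition psi_poly :: "nat \<Rightarrow> nat \<Rightarrow> 'a::field poly" where
  "psi_poly q t = smult (1 / 2)
     (monom 1 q + monom 1 (q ^ (t - 1)) - monom 1 (q ^ (t + 1)) + monom 1 (q ^ (2 * t - 1)))"

definition psi :: "nat \<Rightarrow> nat \<Rightarrow> 'a::field \<Rightarrow> 'a" where
  "psi q t = poly (psi_poly q t)"

text \<open>
  Only the values of a \<open>q\<close>-polynomial on the field matter below, so the notions for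
  \<open>q\<close>-polynomials are stated for the induced maps.
\<close>

definition scattered :: "nat \<Rightarrow> ('a::{field, finite} \<Rightarrow> 'a) \<Rightarrow> bool" where
  "scattered q f \<longleftrightarrow> (\<forall>m. card {x. f x + m * x = 0} \<le> q)"

text \<open>Points of the projective line are the one-dimensional subspaces of \<open>'a ^ 2\<close>.\<close>

definition linear_set :: "('a::field \<Rightarrow> 'a) \<Rightarrow> ('a ^ 2) set set" where
  "linear_set f = {vec.span {vector [x, f x]} | x. x \<noteq> 0}"

definition field_automorphism :: "('a::field \<Rightarrow> 'a) \<Rightarrow> bool" where
  "field_automorphism \<sigma> \<longleftrightarrow> bij \<sigma> \<and> \<sigma> 1 = 1 \<and>
     (\<forall>x y. \<sigma> (x + y) = \<sigma> x + \<sigma> y) \<and> (\<forall>x y. \<sigma> (x * y) = \<sigma> x * \<sigma> y)"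

definition GammaL2 :: "('a::field ^ 2 \<Rightarrow> 'a ^ 2) set" where
  "GammaL2 = {\<lambda>v. A *v (\<chi> i. \<sigma> (v $ i)) | A \<sigma>. invertible A \<and> field_automorphism \<sigma>}"

text \<open>The collineation induced by \<open>g\<close> maps a point \<open>P\<close>, as a set of vectors, to \<open>g ` P\<close>.\<close>

definition PGammaL2 :: "(('a::field ^ 2) set \<Rightarrow> ('a ^ 2) set) set" where
  "PGammaL2 = {\<lambda>P. g ` P | g. g \<in> GammaL2}"

definition PGammaL_equivalent :: "('a::field ^ 2) set set \<Rightarrow> ('a ^ 2) set set \<Rightarrow> bool" where
  "PGammaL_equivalent L L' \<longleftrightarrow> (\<exists>\<phi>\<in>PGammaL2. \<phi> ` L = L')"

definition pseudoregulus_type :: "nat \<Rightarrow> nat \<Rightarrow> ('a::field ^ 2) set set \<Rightarrow> bool" where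
  "pseudoregulus_type q n L \<longleftrightarrow>
     (\<exists>s. 1 \<le> s \<and> s \<le> n - 1 \<and> coprime s n \<and>
          PGammaL_equivalent L (linear_set (\<lambda>x. x ^ (q ^ s))))"

end

theory Submission
  imports Defs "HOL-Number_Theory.Cong" "HOL-Analysis.Determinants"
begin

text \<open>
  Let \<open>N\<close> be the norm to the subfield of order \<open>q\<close>, that is, the power with exponent
  \<open>1 + q + \<dots> + q ^ (n - 1)\<close>. Every point \<open>(x, x ^ q ^ s)\<close> has slope of norm one. So if the linear set of \<open>f\<close>
  is of pseudoregulus type, there is an invertible matrix with rows \<open>(a, b)\<close> and \<open>(c, d)\<close> such that
  \<open>c * x + d * f x\<close> and \<open>a * x + b * f x\<close> have the same nonzero norm for all \<open>x \<noteq> 0\<close>.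

  The key step is that this forces \<open>c * x + d * f x = C * (a * x + b * f x) ^ q ^ j\<close> for some constant \<open>C \<noteq> 0\<close>
  and some \<open>j\<close> (\<open>norm_ratio_imp_frobenius\<close>). It is a statement in the spirit of the theorems of Carlitz and
  McConnel about maps whose difference quotients lie in a proper subgroup. Express the second linear combination as a
  linearized map \<open>g\<close> of the first. As \<open>f\<close> is scattered, the ratios \<open>g y / y\<close> are spread evenly over the elements of norm
  one (\<open>power_sums_vanish\<close>), and so the sum of \<open>(g y / y) ^ d\<close> is zero for every positive \<open>d\<close> less than the
  exponent of \<open>N\<close>. For \<open>d\<close> the sum of \<open>q ^ i\<close> over a proper nonempty set \<open>I\<close> of indices, this power sum is
  up to sign the permanent of a principal submatrix of the Dickson matrix of \<open>g\<close>. On a suitable minimal set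
  \<open>I\<close> the permanent has exactly one nonzero term (\<open>ex_rigid_closed_subset\<close>); this excludes proper \<open>I\<close>, and
  for the full index set it says that \<open>g\<close> has a single term (\<open>linearized_monomial_if_power_sums_vanish\<close>).

  It remains to see that iterates of \<open>psi\<close> admit no such relation. On the eigenspace of \<open>x ^ q ^ t\<close> for the
  eigenvalue \<open>-1\<close> the iterate \<open>f\<close> is \<open>x ^ q ^ k\<close>, and on the one for the eigenvalue \<open>1\<close>, which is the
  subfield of order \<open>q ^ t\<close>, it is the inverse of this map. Comparing coefficients on each eigenspace
  gives conditions on \<open>j\<close> which contradict each other (\<open>psi_funpow_not_frobenius_related\<close>).
\<close>

section \<open>Base-\<open>q\<close> digits modulo \<open>q ^ n - 1\<close>\<close>

lemma digits_unique:
  fixes c d :: "nat \<Rightarrow> nat"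
  assumes "\<And>l. l < n \<Longrightarrow> c l < q" "\<And>l. l < n \<Longrightarrow> d l < q"
    and "(\<Sum>l<n. c l * q ^ l) = (\<Sum>l<n. d l * q ^ l)" and "l < n"
  shows "c l = d l"
  using assms
proof (induction n arbitrary: c d l)
  case (Suc n)
  have split: "(\<Sum>l<Suc n. h l * q ^ l) = h 0 + q * (\<Sum>l<n. h (Suc l) * q ^ l)" for h :: "nat \<Rightarrow> nat"
    by (simp only: sum.lessThan_Suc_shift sum_distrib_left) (simp add: mult_ac)
  have "(c 0 + q * (\<Sum>l<n. c (Suc l) * q ^ l)) mod q = (d 0 + q * (\<Sum>l<n. d (Suc l) * q ^ l)) mod q"
    using Suc.prems(3) by (simp only: split)
  then have zero: "c 0 = d 0"
    using Suc.prems(1)[of 0] Suc.prems(2)[of 0] by simp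
  have "q > 0"
    using Suc.prems(1)[of 0] by simp
  have "q * (\<Sum>l<n. c (Suc l) * q ^ l) = q * (\<Sum>l<n. d (Suc l) * q ^ l)"
    using Suc.prems(3) zero by (simp only: split)
  then have "(\<Sum>l<n. c (Suc l) * q ^ l) = (\<Sum>l<n. d (Suc l) * q ^ l)"
    using \<open>q > 0\<close> by simp
  then have "c (Suc l) = d (Suc l)" if "l < n" for l
    using Suc.IH[of "\<lambda>l. c (Suc l)" "\<lambda>l. d (Suc l)" l] Suc.prems(1,2) that by auto
  then show ?case
    using zero Suc.prems(4) by (cases l) auto
qed simp

lemma geometric_nat: "(q - 1) * (\<Sum>i<n. q ^ i) = q ^ n - (1::nat)" if "q \<ge> 1"
proof -
  have "(q - 1) * (\<Sum>i<n. q ^ i) + 1 = q ^ n"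
    using that
  proof (induction n)
    case (Suc n)
    have "(q - 1) * (\<Sum>i<Suc n. q ^ i) + 1 = (q - 1) * q ^ n + q ^ n"
      using Suc by (simp add: distrib_left)
    also have "\<dots> = q ^ Suc n"
      using that by (simp add: diff_mult_distrib)
    finally show ?case .
  qed simp
  then show ?thesis by linarith
qed

lemma geometric_nat_le: "(\<Sum>i<n. q ^ i) \<le> q ^ n - (1::nat)" if "q \<ge> 2"
proof -
  have "1 * (\<Sum>i<n. q ^ i) \<le> (q - 1) * (\<Sum>i<n. q ^ i)"
    using that by (intro mult_le_mono1) simp
  then show ?thesis using geometric_nat[of q n] that by (simp only: mult_1)
qed

lemma digit_value_le:
  fixes c :: "nat \<Rightarrow> nat"
  assumes "\<And>l. l < n \<Longrightarrow> c l < q" and "q \<ge> 1"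
  shows "(\<Sum>l<n. c l * q ^ l) \<le> q ^ n - 1"
proof -
  have "(\<Sum>l<n. c l * q ^ l) \<le> (\<Sum>l<n. (q - 1) * q ^ l)"
  proof (intro sum_mono mult_right_mono)
    show "c l \<le> q - 1" if "l \<in> {..<n}" for l
      using assms(1)[of l] that by auto
  qed auto
  also have "\<dots> = q ^ n - 1"
    using geometric_nat[OF assms(2)] by (simp add: sum_distrib_left)
  finally show ?thesis .
qed

text \<open>
  Modulo \<open>q ^ n - 1\<close> the weights \<open>q ^ l\<close> are cyclic, so a coefficient \<open>c l \<ge> q\<close> can be lowered by
  \<open>q\<close> at the price of raising its cyclic successor by one. Such a carry keeps the residue and makes
  the sum of the coefficients smaller. Once no carry is possible, the coefficients are genuine digits,
  and they must be those of the sum over \<open>I\<close>. This works because the latter lies strictly between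
  \<open>0\<close> and \<open>q ^ n - 1\<close>, where residues are determined; hence \<open>I\<close> has to be nonempty and proper.
\<close>

lemma digit_sum_minimal:
  fixes c :: "nat \<Rightarrow> nat"
  assumes q: "q \<ge> 2" and I: "I \<subset> {..<n}" "I \<noteq> {}"
    and cong: "[(\<Sum>l<n. c l * q ^ l) = (\<Sum>i\<in>I. q ^ i)] (mod (q ^ n - 1))"
  shows "card I \<le> (\<Sum>l<n. c l) \<and> ((\<Sum>l<n. c l) = card I \<longrightarrow> (\<forall>l<n. l \<notin> I \<longrightarrow> c l = 0))"
  using cong
proof (induction "\<Sum>l<n. c l" arbitrary: c rule: less_induct)
  case less
  show ?case
  proof (cases "\<exists>l<n. q \<le> c l")
    case True
    then obtain l where l: "l < n" "q \<le> c l" by blast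
    \<comment> \<open>the carry, with wrap-around at the last position\<close>
    define l' where "l' = (if Suc l < n then Suc l else 0)"
    have l': "l' < n" using l by (auto simp: l'_def)
    define c1 where "c1 = c(l := c l - q)"
    define c2 where "c2 = c1(l' := c1 l' + 1)"
    have s1: "(\<Sum>i<n. c1 i * w i) + q * w l = (\<Sum>i<n. c i * w i)" for w :: "nat \<Rightarrow> nat"
    proof -
      have "(\<Sum>i<n. c1 i * w i) = (c l - q) * w l + (\<Sum>i\<in>{..<n}-{l}. c i * w i)"
        using l by (subst sum.remove[of _ l]) (auto simp: c1_def)
      moreover have "(\<Sum>i<n. c i * w i) = c l * w l + (\<Sum>i\<in>{..<n}-{l}. c i * w i)"
        using l by (subst sum.remove[of _ l]) auto
      moreover have "(c l - q) * w l + q * w l = c l * w l"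
        using l by (simp add: diff_mult_distrib)
      ultimately show ?thesis by linarith
    qed
    have s2: "(\<Sum>i<n. c2 i * w i) = (\<Sum>i<n. c1 i * w i) + w l'" for w :: "nat \<Rightarrow> nat"
    proof -
      have "(\<Sum>i<n. c2 i * w i) = (c1 l' + 1) * w l' + (\<Sum>i\<in>{..<n}-{l'}. c1 i * w i)"
        using l' by (subst sum.remove[of _ l']) (auto simp: c2_def)
      moreover have "(\<Sum>i<n. c1 i * w i) = c1 l' * w l' + (\<Sum>i\<in>{..<n}-{l'}. c1 i * w i)"
        using l' by (subst sum.remove[of _ l']) auto
      ultimately show ?thesis by simp
    qed
    have lt: "(\<Sum>i<n. c2 i) < (\<Sum>i<n. c i)"
      using s1[of "\<lambda>_. 1"] s2[of "\<lambda>_. 1"] q by simp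
    have "[q * q ^ l = q ^ l'] (mod (q ^ n - 1))"
    proof (cases "Suc l < n")
      case False
      then have "Suc l = n" using l by simp
      then have "q * q ^ l = 1 + (q ^ n - 1)"
        using q by (simp flip: power_Suc)
      then show ?thesis using False
        by (simp add: l'_def cong_def del: One_nat_def)
    qed (simp add: l'_def)
    then have "[(\<Sum>i<n. c1 i * q ^ i) + q ^ l' = (\<Sum>i<n. c1 i * q ^ i) + q * q ^ l] (mod (q ^ n - 1))"
      by (simp add: cong_add_lcancel_nat cong_sym)
    then have "[(\<Sum>i<n. c2 i * q ^ i) = (\<Sum>i<n. c i * q ^ i)] (mod (q ^ n - 1))"
      using s1[of "\<lambda>l. q ^ l"] s2[of "\<lambda>l. q ^ l"] by simp
    then have "[(\<Sum>i<n. c2 i * q ^ i) = (\<Sum>i\<in>I. q ^ i)] (mod (q ^ n - 1))"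
      using less.prems cong_trans by blast
    then have "card I \<le> (\<Sum>l<n. c2 l)"
      using less.hyps[OF lt] by blast
    then show ?thesis using lt by simp
  next
    case False
    then have small: "c l < q" if "l < n" for l using that by auto
    define e where "e l = (if l \<in> I then 1 else 0::nat)" for l
    have e_sum: "(\<Sum>l<n. e l * w l) = (\<Sum>i\<in>I. w i)" for w :: "nat \<Rightarrow> nat"
    proof -
      have "(\<Sum>l<n. e l * w l) = (\<Sum>l<n. if l \<in> I then w l else 0)"
        by (intro sum.cong) (auto simp: e_def)
      also have "\<dots> = sum w ({..<n} \<inter> I)"
        by (simp add: sum.inter_restrict)
      also have "{..<n} \<inter> I = I" using I by auto
      finally show ?thesis .
    qed
    \<comment> \<open>no carry is possible: both sides are base-\<open>q\<close> expansions\<close>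
    let ?v = "\<Sum>l<n. c l * q ^ l" and ?d = "\<Sum>i\<in>I. q ^ i"
    have "finite I" using I finite_subset by blast
    then have d_pos: "?d > 0"
      using I q by (simp add: sum_pos)
    have v_le: "?v \<le> q ^ n - 1"
      using digit_value_le[of n c q] small q by simp
    have d_less: "?d < q ^ n - 1"
    proof -
      have "?d < (\<Sum>i<n. q ^ i)"
        using I q by (intro sum_strict_mono2[of _ _ "SOME b. b \<in> {..<n} - I"])
          (use some_in_eq[of "{..<n} - I"] in auto)
      also have "\<dots> \<le> q ^ n - 1" using geometric_nat_le q .
      finally show ?thesis .
    qed
    have "?v = ?d"
    proof (cases "?v = q ^ n - 1")
      case True
      then have "?d mod (q ^ n - 1) = 0"
        using less.prems by (simp add: cong_def)
      then show ?thesis using d_less d_pos by simp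
    next
      case False
      then show ?thesis
        using less.prems v_le d_less by (simp add: cong_def)
    qed
    then have eq: "c l = e l" if "l < n" for l
      using digits_unique[of n c q e l] small q e_sum[of "\<lambda>l. q ^ l"] that by (auto simp: e_def)
    have "(\<Sum>l<n. c l) = (\<Sum>l<n. e l * 1)"
      using eq by simp
    also have "\<dots> = card I"
      using e_sum[of "\<lambda>_. 1"] by simp
    finally show ?thesis using eq by (auto simp: e_def)
  qed
qed

lemma cyclic_shift:
  fixes i l n :: nat
  assumes "i < n" "l < n"
  shows cyclic_add_diff: "(i + (l + n - i) mod n) mod n = l"
    and cyclic_diff_add: "((i + l) mod n + n - i) mod n = l"
proof -
  show "(i + (l + n - i) mod n) mod n = l"
    using assms by (simp add: mod_add_right_eq)
  show "((i + l) mod n + n - i) mod n = l"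
  proof (cases "i + l < n")
    case False
    then have "(i + l) mod n = i + l - n"
      using assms le_mod_geq[of n "i + l"] by simp
    then show ?thesis using assms False by simp
  qed (use assms in simp)
qed

text \<open>
  Collecting equal exponents turns the left-hand side into a sum with coefficients
  \<open>card {i \<in> I. \<phi> i = l}\<close>, whose total \<open>card I\<close> is the least one possible for this residue.
\<close>

lemma sum_powers_cong_imp_maps_to:
  fixes \<phi> :: "nat \<Rightarrow> nat" and q :: nat
  assumes q: "q \<ge> 2" and I: "I \<subset> {..<n}" "I \<noteq> {}" and \<phi>: "\<phi> \<in> I \<rightarrow> {..<n}"
    and cong: "[(\<Sum>i\<in>I. q ^ \<phi> i) = (\<Sum>i\<in>I. q ^ i)] (mod (q ^ n - 1))"
  shows "\<phi> \<in> I \<rightarrow> I"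
proof
  fix i assume i: "i \<in> I"
  define c where "c l = card {i \<in> I. \<phi> i = l}" for l
  have fin: "finite I" using I finite_subset by blast
  have c_sum: "(\<Sum>l<n. c l * w l) = (\<Sum>i\<in>I. w (\<phi> i))" for w :: "nat \<Rightarrow> nat"
  proof -
    have "(\<Sum>i\<in>I. w (\<phi> i)) = (\<Sum>l<n. \<Sum>i\<in>{i \<in> I. \<phi> i = l}. w (\<phi> i))"
      by (rule sum.group[symmetric]) (use \<phi> fin in auto)
    also have "\<dots> = (\<Sum>l<n. \<Sum>i\<in>{i \<in> I. \<phi> i = l}. w l)"
      by (intro sum.cong) auto
    finally show ?thesis by (simp add: c_def)
  qed
  have "{j \<in> I. \<phi> j = \<phi> i} \<noteq> {}"
    using i by blast
  then have "c (\<phi> i) \<noteq> 0"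
    using fin by (simp add: c_def card_eq_0_iff)
  moreover have "(\<Sum>l<n. c l) = card I"
    using c_sum[of "\<lambda>_. 1"] by simp
  moreover have "[(\<Sum>l<n. c l * q ^ l) = (\<Sum>i\<in>I. q ^ i)] (mod (q ^ n - 1))"
    using cong by (simp only: c_sum)
  note digit_sum_minimal[OF q I this]
  moreover have "\<phi> i < n"
    using \<phi> i by auto
  ultimately show "\<phi> i \<in> I" by metis
qed

section \<open>Minimal closed subsets of a digraph\<close>

text \<open>
  Take \<open>I\<close> of least size among the nonempty sets in which every vertex keeps a successor. Every
  choice \<open>\<phi>\<close> of successors inside \<open>I\<close> is onto, since \<open>\<phi> ` I\<close> is again closed. If two choices
  differed at a vertex, changing one of them at that vertex only would give a choice which misses a
  value. So the choice is unique, and it is a permutation.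
\<close>

lemma ex_rigid_closed_subset:
  assumes V: "finite V" "V \<noteq> {}" "\<And>i. i \<in> V \<Longrightarrow> \<exists>j\<in>V. E i j"
  obtains I where "I \<subseteq> V" "I \<noteq> {}" "\<And>i. i \<in> I \<Longrightarrow> \<exists>!j. j \<in> I \<and> E i j"
    "bij_betw (\<lambda>i. THE j. j \<in> I \<and> E i j) I I"
proof -
  define closed where "closed J \<longleftrightarrow> J \<subseteq> V \<and> J \<noteq> {} \<and> (\<forall>i\<in>J. \<exists>j\<in>J. E i j)" for J
  have "closed V" using V by (auto simp: closed_def)
  then obtain I where I: "closed I" and min: "\<And>J. closed J \<Longrightarrow> card I \<le> card J"
    using ex_has_least_nat[of closed V card] by blast
  have fin: "finite I" using I V finite_subset by (auto simp: closed_def)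
  have bij: "bij_betw \<phi> I I" if "\<phi> \<in> I \<rightarrow> I" "\<And>i. i \<in> I \<Longrightarrow> E i (\<phi> i)" for \<phi>
  proof -
    have "closed (\<phi> ` I)"
      using I that unfolding closed_def by blast
    then have "\<phi> ` I = I"
      using min[of "\<phi> ` I"] that(1) fin by (intro card_seteq) auto
    then show ?thesis
      using fin by (simp add: bij_betw_def finite_surj_inj)
  qed
  obtain \<phi> where \<phi>: "\<And>i. i \<in> I \<Longrightarrow> \<phi> i \<in> I \<and> E i (\<phi> i)"
    using I unfolding closed_def by metis
  have uniq: "j = \<phi> i" if "i \<in> I" "j \<in> I" "E i j" for i j
  proof -
    have "bij_betw (\<phi>(i := j)) I I"
      using that \<phi> by (intro bij) auto
    then have "(\<phi>(i := j)) ` I = I" by (simp add: bij_betw_def)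
    moreover have "bij_betw \<phi> I I"
      using \<phi> by (intro bij) auto
    ultimately have "\<phi> i \<in> (\<phi>(i := j)) ` I" "inj_on \<phi> I"
      using \<phi> that by (auto simp: bij_betw_def)
    then obtain l where l: "l \<in> I" "\<phi> i = (\<phi>(i := j)) l" by blast
    with \<open>inj_on \<phi> I\<close> \<open>i \<in> I\<close> show ?thesis
      by (cases "l = i") (auto dest: inj_onD)
  qed
  have ex1: "\<exists>!j. j \<in> I \<and> E i j" if "i \<in> I" for i
    using \<phi> uniq that by blast
  then have "(THE j. j \<in> I \<and> E i j) \<in> I \<and> E i (THE j. j \<in> I \<and> E i j)" if "i \<in> I" for i
    using theI'[of "\<lambda>j. j \<in> I \<and> E i j"] that by blast
  then have "bij_betw (\<lambda>i. THE j. j \<in> I \<and> E i j) I I"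
    by (intro bij) auto
  then show thesis
    using that[of I] I ex1 unfolding closed_def by blast
qed

section \<open>Power sums and Frobenius powers in a finite field\<close>

lemma sum_power_eq_0_if_invariant:
  fixes u :: "'a::field"
  assumes "bij_betw ((*) u) D D" and "u ^ d \<noteq> 1"
  shows "(\<Sum>z\<in>D. z ^ d) = 0"
proof -
  have "(\<Sum>z\<in>D. z ^ d) = (\<Sum>z\<in>D. (u * z) ^ d)"
    using sum.reindex_bij_betw[OF assms(1), of "\<lambda>z. z ^ d"] by simp
  also have "\<dots> = u ^ d * (\<Sum>z\<in>D. z ^ d)"
    by (simp add: power_mult_distrib sum_distrib_left)
  finally have "(1 - u ^ d) * (\<Sum>z\<in>D. z ^ d) = 0"
    by (simp add: algebra_simps)
  with assms(2) show ?thesis by simp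
qed

lemma card_roots_of_unity_le:
  assumes "d > 0"
  shows "card {z :: 'a::field. z ^ d = 1} \<le> d"
proof -
  let ?p = "monom 1 d - 1 :: 'a poly"
  have "poly.coeff ?p d = 1" using assms by simp
  then have "?p \<noteq> 0" by force
  moreover have "degree ?p \<le> d"
    by (intro degree_diff_le) (auto simp: degree_monom_eq)
  moreover have "{z :: 'a. z ^ d = 1} = {z. poly ?p z = 0}"
    by (simp add: poly_monom)
  ultimately show ?thesis
    using card_poly_roots_bound[of ?p] by simp
qed

text \<open>
  The argument \<open>ty\<close> only serves to fix the field as a type parameter of the locale.
\<close>

locale galois_field =
  fixes q n :: nat and ty :: "'a::{field, finite} itself"
  assumes primepow_q: "primepow q" and card_field: "CARD('a) = q ^ n"
begin

lemma q_ge_2: "q \<ge> 2"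
  using primepow_gt_Suc_0[OF primepow_q] by simp

lemma prime_CHAR: "prime CHAR('a)"
  by (simp add: finite_imp_CHAR_pos prime_CHAR_semidom)

lemma CHAR_dvd_card: "CHAR('a) dvd q ^ n"
proof -
  have "(\<Sum>x\<in>UNIV. x :: 'a) = (\<Sum>x\<in>UNIV. x + 1)"
    by (rule sum.reindex_bij_witness[of _ "\<lambda>x. x + 1" "\<lambda>x. x - 1"]) auto
  then have "of_nat (CARD('a)) = (0 :: 'a)"
    unfolding sum.distrib by simp
  then have "of_nat (q ^ n) = (0 :: 'a)" by (simp only: card_field)
  then show ?thesis by (simp only: of_nat_eq_0_iff_char_dvd)
qed

lemma q_eq_CHAR_power: "\<exists>e. q = CHAR('a) ^ e"
proof -
  obtain p e where p: "prime p" "q = p ^ e"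
    using primepow_q by (auto simp: primepow_def)
  have "CHAR('a) dvd p ^ (e * n)"
    using CHAR_dvd_card by (simp only: p(2) power_mult)
  then have "CHAR('a) = p"
    using prime_CHAR p(1) prime_dvd_power primes_dvd_imp_eq by blast
  then show ?thesis using p by blast
qed

lemma q_power_eq_CHAR_power: "\<exists>e. q ^ i = CHAR('a) ^ e"
  using q_eq_CHAR_power by (metis power_mult)

lemma frobenius_add: "(x + y :: 'a) ^ q ^ i = x ^ q ^ i + y ^ q ^ i"
  using q_power_eq_CHAR_power[of i] freshmans_dream'[OF prime_CHAR] by blast

lemma frobenius_sum: "(\<Sum>x\<in>X. h x :: 'a) ^ q ^ i = (\<Sum>x\<in>X. h x ^ q ^ i)"
  using q_power_eq_CHAR_power[of i] freshmans_dream_sum'[OF prime_CHAR] by blast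

lemma frobenius_minus: "(- x :: 'a) ^ q ^ i = - (x ^ q ^ i)"
proof -
  have "x ^ q ^ i + (- x) ^ q ^ i = 0"
    using q_ge_2 by (simp flip: frobenius_add)
  then show ?thesis by (simp add: eq_neg_iff_add_eq_0 add.commute)
qed

lemma frobenius_diff: "(x - y :: 'a) ^ q ^ i = x ^ q ^ i - y ^ q ^ i"
  using frobenius_add[of x "- y" i] by (simp add: frobenius_minus)

lemma frobenius_frobenius: "((x :: 'a) ^ q ^ i) ^ q ^ j = x ^ q ^ (i + j)"
  by (simp add: power_add flip: power_mult)

lemma power_card_minus_1: "(x :: 'a) ^ (q ^ n - 1) = 1" if "x \<noteq> 0"
proof -
  have "(\<Prod>y\<in>-{0}. y) = (\<Prod>y\<in>-{0}. x * y)"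
    by (rule prod.reindex_bij_witness[of _ "\<lambda>y. x * y" "\<lambda>y. y / x"]) (use that in auto)
  also have "\<dots> = x ^ card (- {0::'a}) * (\<Prod>y\<in>-{0}. y)"
    by (simp add: prod.distrib)
  finally have "x ^ card (- {0::'a}) = 1" by simp
  then show ?thesis by (simp add: Compl_eq_Diff_UNIV card_Diff_singleton card_field)
qed

lemma power_card: "(x :: 'a) ^ q ^ n = x"
proof (cases "x = 0")
  case False
  have "x ^ q ^ n = x ^ (q ^ n - 1) * x"
    using q_ge_2 by (simp flip: power_Suc2)
  then show ?thesis using power_card_minus_1[OF False] by simp
qed (use q_ge_2 in simp)

lemma n_pos: "n > 0"
proof (rule ccontr)
  assume "\<not> n > 0"
  then have "CARD('a) = 1" using card_field by simp
  moreover have "card {0, 1 :: 'a} \<le> CARD('a)" by (intro card_mono) auto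
  ultimately show False by simp
qed

lemma frobenius_mod: "(x :: 'a) ^ q ^ (i mod n) = x ^ q ^ i"
proof -
  have "y ^ q ^ (n * l) = y" for l and y :: 'a
    by (induction l) (simp_all add: power_card flip: frobenius_frobenius)
  then have "(x ^ q ^ (n * (i div n))) ^ q ^ (i mod n) = x ^ q ^ (i mod n)"
    by simp
  then have "x ^ q ^ (n * (i div n) + i mod n) = x ^ q ^ (i mod n)"
    by (simp only: frobenius_frobenius)
  then show ?thesis by simp
qed

lemma power_mod_card: "(x :: 'a) ^ (e mod (q ^ n - 1)) = x ^ e" if "x \<noteq> 0"
proof -
  have "x ^ e = x ^ ((q ^ n - 1) * (e div (q ^ n - 1)) + e mod (q ^ n - 1))" by simp
  also have "\<dots> = x ^ (e mod (q ^ n - 1))"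
    using power_card_minus_1[OF that] by (simp only: power_add power_mult) simp
  finally show ?thesis by simp
qed

lemma card_nonzero: "card (- {0 :: 'a}) = q ^ n - 1"
  by (simp add: Compl_eq_Diff_UNIV card_Diff_singleton card_field)

text \<open>
  If \<open>q ^ n - 1\<close> does not divide \<open>e\<close>, then some \<open>u \<noteq> 0\<close> has \<open>u ^ e \<noteq> 1\<close>, since otherwise the
  polynomial \<open>X ^ r - 1\<close>, with \<open>r\<close> the residue of \<open>e\<close>, would have more than \<open>r\<close> roots.
  Multiplication by \<open>u\<close> permutes the nonzero elements.
\<close>

lemma sum_powers_nonzero:
  "(\<Sum>x\<in>-{0::'a}. x ^ e) = (if q ^ n - 1 dvd e then - 1 else 0)"
proof (cases "q ^ n - 1 dvd e")
  case True
  then have "x ^ e = 1" if "x \<noteq> 0" for x :: 'a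
    using power_mod_card[OF that, of e] by (simp add: dvd_eq_mod_eq_0)
  then have "(\<Sum>x\<in>-{0::'a}. x ^ e) = of_nat (q ^ n - 1)"
    by (simp add: card_nonzero)
  also have "\<dots> = of_nat (CARD('a)) - 1"
    using q_ge_2 by (simp add: card_field of_nat_diff)
  also have "of_nat (CARD('a)) = (0 :: 'a)"
    using CHAR_dvd_card by (simp only: card_field of_nat_eq_0_iff_char_dvd)
  finally show ?thesis using True by simp
next
  case False
  let ?r = "e mod (q ^ n - 1)"
  have "?r > 0" using False by (simp add: mod_greater_zero_iff_not_dvd)
  have "q ^ n > 1" using q_ge_2 n_pos by (metis One_nat_def Suc_1 Suc_le_lessD one_less_power)
  then have "?r < q ^ n - 1" by simp
  have "\<exists>u. u \<noteq> (0 :: 'a) \<and> u ^ e \<noteq> 1"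
  proof (rule ccontr)
    assume "\<not> ?thesis"
    then have "- {0 :: 'a} \<subseteq> {z. z ^ ?r = 1}"
      using power_mod_card by auto
    then have "q ^ n - 1 \<le> card {z :: 'a. z ^ ?r = 1}"
      by (subst card_nonzero[symmetric], intro card_mono) auto
    then show False
      using card_roots_of_unity_le[where ?'a = 'a, OF \<open>?r > 0\<close>] \<open>?r < q ^ n - 1\<close> by simp
  qed
  then obtain u :: 'a where u: "u \<noteq> 0" "u ^ e \<noteq> 1" by blast
  have "bij_betw ((*) u) (- {0}) (- {0})"
    by (rule bij_betw_byWitness[of _ "\<lambda>y. y / u"]) (use u in auto)
  then show ?thesis
    using sum_power_eq_0_if_invariant u False by auto
qed

section \<open>Linearized maps with vanishing power sums of ratios\<close>

text \<open>
  The coefficient of \<open>y ^ q ^ l\<close> in \<open>g y ^ q ^ i\<close> is \<open>a (l - i) ^ q ^ i\<close>, with indices taken modulo \<open>n\<close>.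
  Expanding the product of the factors \<open>g y ^ q ^ i\<close> over \<open>i \<in> I\<close> and summing over \<open>y\<close>, only those
  maps \<open>\<phi>\<close> survive whose exponents satisfy the congruence of
  \<open>sum_powers_cong_imp_maps_to\<close>, that is, maps from \<open>I\<close> to itself. Thus the power sum is, up to sign, the
  permanent of the principal submatrix of \<open>(a (l - i) ^ q ^ i)\<close> with index set \<open>I\<close>. Rigidity of \<open>I\<close>
  leaves a single term of this permanent, a product of nonzero entries.
\<close>

lemma power_sum_of_rigid_subset:
  fixes a :: "nat \<Rightarrow> 'a" and g :: "'a \<Rightarrow> 'a"
  defines "E \<equiv> \<lambda>i l. a ((l + n - i) mod n) \<noteq> 0"
  assumes g: "\<And>y. g y = (\<Sum>j<n. a j * y ^ q ^ j)"
    and I: "I \<subset> {..<n}" "I \<noteq> {}"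
    and ex1: "\<And>i. i \<in> I \<Longrightarrow> \<exists>!j. j \<in> I \<and> E i j"
    and bij: "bij_betw (\<lambda>i. THE j. j \<in> I \<and> E i j) I I"
  shows "(\<Sum>y\<in>-{0}. (g y / y) ^ (\<Sum>i\<in>I. q ^ i)) \<noteq> 0"
proof -
  define A where "A i l = a ((l + n - i) mod n) ^ q ^ i" for i l
  define d where "d = (\<Sum>i\<in>I. q ^ i)"
  define \<phi> where "\<phi> = restrict (\<lambda>i. THE j. j \<in> I \<and> E i j) I"
  have fin: "finite I" using I finite_subset by blast
  have \<phi>: "\<phi> i \<in> I" "E i (\<phi> i)" if "i \<in> I" for i
    using theI'[OF ex1[OF that]] that by (auto simp: \<phi>_def)
  have \<phi>_unique: "\<phi> i = j" if "i \<in> I" "j \<in> I" "E i j" for i j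
    using that ex1[OF that(1)] by (auto simp: \<phi>_def intro!: the_equality)
  have "bij_betw \<phi> I I"
    using bij by (subst bij_betw_cong[of I \<phi>]) (auto simp: \<phi>_def PiE_def)
  have d_le: "d \<le> q ^ n - 1"
  proof -
    have "d \<le> (\<Sum>i<n. q ^ i)"
      unfolding d_def using I by (intro sum_mono2) auto
    also have "\<dots> \<le> q ^ n - 1" using geometric_nat_le q_ge_2 .
    finally show ?thesis .
  qed
  have g_frob: "g y ^ q ^ i = (\<Sum>l<n. A i l * y ^ q ^ l)" if "i < n" for i y
  proof -
    have "g y ^ q ^ i = (\<Sum>j<n. a j ^ q ^ i * y ^ q ^ ((i + j) mod n))"
      by (simp add: g frobenius_sum power_mult_distrib frobenius_frobenius frobenius_mod add.commute)
    also have "\<dots> = (\<Sum>l<n. A i l * y ^ q ^ l)"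
      unfolding A_def
      by (rule sum.reindex_bij_witness[of _ "\<lambda>l. (l + n - i) mod n" "\<lambda>j. (i + j) mod n"])
        (use that n_pos in \<open>auto simp: cyclic_add_diff cyclic_diff_add\<close>)
    finally show ?thesis .
  qed
  let ?P = "I \<rightarrow>\<^sub>E {..<n}"
  have expand: "(g y / y) ^ d = (\<Sum>\<psi>\<in>?P. (\<Prod>i\<in>I. A i (\<psi> i)) * y ^ ((\<Sum>i\<in>I. q ^ \<psi> i) + (q ^ n - 1 - d)))"
    if "y \<noteq> 0" for y
  proof -
    \<comment> \<open>division by \<open>y ^ d\<close> is multiplication by a power with a nonnegative exponent\<close>
    have "y ^ d * y ^ (q ^ n - 1 - d) = 1"
      using power_card_minus_1[OF that] d_le by (simp only: le_add_diff_inverse flip: power_add)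
    then have "(g y / y) ^ d = g y ^ d * y ^ (q ^ n - 1 - d)"
      using that by (simp add: power_divide divide_simps mult_ac)
    also have "g y ^ d = (\<Prod>i\<in>I. g y ^ q ^ i)"
      by (simp add: d_def power_sum)
    also have "\<dots> = (\<Prod>i\<in>I. \<Sum>l\<in>{..<n}. A i l * y ^ q ^ l)"
      using I by (intro prod.cong g_frob) auto
    also have "\<dots> = (\<Sum>\<psi>\<in>?P. \<Prod>i\<in>I. A i (\<psi> i) * y ^ q ^ \<psi> i)"
      by (rule prod_sum_PiE) (use fin in auto)
    finally show ?thesis
      by (simp only: sum_distrib_right prod.distrib power_add power_sum mult.assoc)
  qed
  have "(\<Sum>y\<in>-{0}. (g y / y) ^ d) =
      (\<Sum>y\<in>-{0}. \<Sum>\<psi>\<in>?P. (\<Prod>i\<in>I. A i (\<psi> i)) * y ^ ((\<Sum>i\<in>I. q ^ \<psi> i) + (q ^ n - 1 - d)))"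
    by (rule sum.cong[OF refl], rule expand) simp
  also have "\<dots> =
      (\<Sum>\<psi>\<in>?P. (\<Prod>i\<in>I. A i (\<psi> i)) * (\<Sum>y\<in>-{0}. y ^ ((\<Sum>i\<in>I. q ^ \<psi> i) + (q ^ n - 1 - d))))"
    by (subst sum.swap) (simp only: sum_distrib_left)
  also have "\<dots> = (\<Sum>\<psi>\<in>{\<phi>}. (\<Prod>i\<in>I. A i (\<psi> i)) * (\<Sum>y\<in>-{0}. y ^ ((\<Sum>i\<in>I. q ^ \<psi> i) + (q ^ n - 1 - d))))"
  proof (rule sum.mono_neutral_right)
    show "{\<phi>} \<subseteq> ?P" using \<phi>(1) I by (auto simp: \<phi>_def)
    show "finite ?P" using fin by (intro finite_PiE) auto
    show "\<forall>\<psi>\<in>?P - {\<phi>}. (\<Prod>i\<in>I. A i (\<psi> i)) *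
        (\<Sum>y\<in>-{0}. y ^ ((\<Sum>i\<in>I. q ^ \<psi> i) + (q ^ n - 1 - d))) = 0"
    proof (rule ballI, rule ccontr)
      fix \<psi> assume \<psi>: "\<psi> \<in> ?P - {\<phi>}"
      assume nz: "(\<Prod>i\<in>I. A i (\<psi> i)) *
        (\<Sum>y\<in>-{0}. y ^ ((\<Sum>i\<in>I. q ^ \<psi> i) + (q ^ n - 1 - d))) \<noteq> 0"
      have E: "E i (\<psi> i)" if "i \<in> I" for i
      proof -
        have "A i (\<psi> i) \<noteq> 0" using nz fin that by auto
        then show ?thesis
          using q_ge_2 by (auto simp: A_def E_def power_0_left)
      qed
      have "q ^ n - 1 dvd (\<Sum>i\<in>I. q ^ \<psi> i) + (q ^ n - 1 - d)"
        using nz by (simp add: sum_powers_nonzero split: if_splits)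
      then have "[(\<Sum>i\<in>I. q ^ \<psi> i) + (q ^ n - 1 - d) = d + (q ^ n - 1 - d)] (mod (q ^ n - 1))"
        using d_le by (simp only: cong_def dvd_eq_mod_eq_0 le_add_diff_inverse) simp
      then have "[(\<Sum>i\<in>I. q ^ \<psi> i) = d] (mod (q ^ n - 1))"
        by (simp add: cong_add_rcancel_nat)
      then have "\<psi> \<in> I \<rightarrow> I"
        using \<psi> sum_powers_cong_imp_maps_to[OF q_ge_2 I, of \<psi>] unfolding d_def by auto
      then have "\<psi> i = \<phi> i" if "i \<in> I" for i
        using \<phi>_unique E that by (metis funcset_mem)
      then have "\<psi> = \<phi>"
        using \<psi> by (intro extensionalityI[of \<psi> I \<phi>]) (auto simp: \<phi>_def PiE_def)
      then show False using \<psi> by simp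
    qed
  qed
  also have "\<dots> = - (\<Prod>i\<in>I. A i (\<phi> i))"
  proof -
    have "(\<Sum>i\<in>I. q ^ \<phi> i) = d"
      unfolding d_def using sum.reindex_bij_betw[OF \<open>bij_betw \<phi> I I\<close>, of "\<lambda>i. q ^ i"] by simp
    then have "(\<Sum>i\<in>I. q ^ \<phi> i) + (q ^ n - 1 - d) = q ^ n - 1"
      using d_le by linarith
    then have "(\<Sum>y\<in>-{0::'a}. y ^ ((\<Sum>i\<in>I. q ^ \<phi> i) + (q ^ n - 1 - d))) = - 1"
      by (simp only: sum_powers_nonzero dvd_refl if_True)
    then show ?thesis by simp
  qed
  finally have "(\<Sum>y\<in>-{0}. (g y / y) ^ d) = - (\<Prod>i\<in>I. A i (\<phi> i))" .
  moreover have "A i (\<phi> i) \<noteq> 0" if "i \<in> I" for i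
    using \<phi>(2)[OF that] by (simp add: A_def E_def)
  ultimately show ?thesis
    using fin unfolding d_def by simp
qed

text \<open>
  Join \<open>i\<close> to \<open>l\<close> when \<open>a (l - i) \<noteq> 0\<close> (indices modulo \<open>n\<close>). A rigid closed set of this digraph
  cannot be proper, because the corresponding power sum would be nonzero although its exponent is less than
  \<open>1 + q + \<dots> + q ^ (n - 1)\<close>. So the rigid set consists of all indices, and then the vertex \<open>0\<close> has a
  single successor, which says that only one coefficient of \<open>g\<close> is nonzero.
\<close>

theorem linearized_monomial_if_power_sums_vanish:
  fixes a :: "nat \<Rightarrow> 'a" and g :: "'a \<Rightarrow> 'a"
  assumes g: "\<And>y. g y = (\<Sum>j<n. a j * y ^ q ^ j)"
    and nonzero: "\<exists>y. g y \<noteq> 0"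
    and power_sums: "\<And>d. 0 < d \<Longrightarrow> d < (\<Sum>i<n. q ^ i) \<Longrightarrow> (\<Sum>y\<in>-{0}. (g y / y) ^ d) = 0"
  obtains c j where "c \<noteq> 0" "j < n" "\<And>y. g y = c * y ^ q ^ j"
proof -
  define E where "E = (\<lambda>i l. a ((l + n - i) mod n) \<noteq> 0)"
  have "\<exists>j<n. a j \<noteq> 0"
  proof (rule ccontr)
    assume "\<not> ?thesis"
    then have "g y = 0" for y by (simp add: g)
    then show False using nonzero by simp
  qed
  then obtain j where j: "j < n" "a j \<noteq> 0" by blast
  have E_shift: "E i ((i + l) mod n) \<longleftrightarrow> a l \<noteq> 0" if "i < n" "l < n" for i l
    using that by (simp add: E_def cyclic_diff_add)
  have out: "\<exists>l\<in>{..<n}. E i l" if "i \<in> {..<n}" for i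
    using that j E_shift[of i j] n_pos by (intro bexI[of _ "(i + j) mod n"]) auto
  obtain I where I: "I \<subseteq> {..<n}" "I \<noteq> {}" "\<And>i. i \<in> I \<Longrightarrow> \<exists>!l. l \<in> I \<and> E i l"
    "bij_betw (\<lambda>i. THE l. l \<in> I \<and> E i l) I I"
  proof (rule ex_rigid_closed_subset)
    show "finite {..<n}" "{..<n} \<noteq> {}" using n_pos by auto
    show "\<exists>l\<in>{..<n}. E i l" if "i \<in> {..<n}" for i by (rule out[OF that])
  qed (rule that)
  have I_eq: "I = {..<n}"
  proof (rule ccontr)
    assume "I \<noteq> {..<n}"
    with I have I': "I \<subset> {..<n}" by blast
    have fin: "finite I" using I finite_subset by blast
    have "(\<Sum>i\<in>I. q ^ i) > 0"
      using fin I q_ge_2 by (intro sum_pos) auto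
    moreover have "(\<Sum>i\<in>I. q ^ i) < (\<Sum>i<n. q ^ i)"
      using I' q_ge_2 by (intro sum_strict_mono2[of _ _ "SOME b. b \<in> {..<n} - I"])
          (use some_in_eq[of "{..<n} - I"] in auto)
    ultimately have "(\<Sum>y\<in>-{0}. (g y / y) ^ (\<Sum>i\<in>I. q ^ i)) = 0"
      by (rule power_sums)
    moreover have "(\<Sum>y\<in>-{0}. (g y / y) ^ (\<Sum>i\<in>I. q ^ i)) \<noteq> 0"
      by (rule power_sum_of_rigid_subset[OF g I' I(2) I(3,4)[unfolded E_def]])
    ultimately show False by contradiction
  qed
  have only_j: "l = j" if "l < n" "a l \<noteq> 0" for l
  proof -
    have "E 0 l" "E 0 j"
      using E_shift[of 0 l] E_shift[of 0 j] that j by simp_all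
    moreover have "\<exists>!l. l \<in> {..<n} \<and> E 0 l"
      using I(3)[of 0] n_pos unfolding I_eq by simp
    ultimately show ?thesis
      using that j by blast
  qed
  have "g y = a j * y ^ q ^ j" for y
  proof -
    have "(\<Sum>l\<in>{..<n} - {j}. a l * y ^ q ^ l) = 0"
      by (intro sum.neutral) (use only_j in force)
    then show ?thesis
      unfolding g using j by (simp add: sum.remove[of _ j])
  qed
  then show thesis using that j by blast
qed

section \<open>Scattered maps and ratios of norm one\<close>

text \<open>
  The exponent \<open>1 + q + \<dots> + q ^ (n - 1)\<close> is that of the norm from the field of order \<open>q ^ n\<close> to its
  subfield of order \<open>q\<close>.
\<close>

lemma sum_q_powers_pos: "(\<Sum>i<n. q ^ i) > 0"
  using q_ge_2 n_pos by (intro sum_pos) auto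

text \<open>
  The norm lies in the subfield of order \<open>q\<close>, which is fixed by Frobenius.
\<close>

lemma norm_frobenius: "((x :: 'a) ^ q ^ s) ^ (\<Sum>i<n. q ^ i) = x ^ (\<Sum>i<n. q ^ i)"
proof (induction s)
  case (Suc s)
  let ?m = "\<Sum>i<n. q ^ i"
  have "q * ?m = (q - 1) * ?m + ?m"
    using q_ge_2 by (simp add: diff_mult_distrib)
  also have "\<dots> = (q ^ n - 1) + ?m"
    using geometric_nat[of q n] q_ge_2 by simp
  finally have m: "q * ?m = (q ^ n - 1) + ?m" .
  have "y ^ (q * ?m) = y ^ ?m" for y :: 'a
  proof (cases "y = 0")
    case True
    then show ?thesis using sum_q_powers_pos q_ge_2 by (simp add: power_0_left)
  next
    case False
    then show ?thesis
      using power_card_minus_1[OF False] by (simp only: m power_add mult_1)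
  qed
  then have "((x ^ q ^ s) ^ q) ^ ?m = (x ^ q ^ s) ^ ?m"
    by (simp only: power_mult)
  then show ?case using Suc by (simp add: mult.commute flip: power_mult)
qed simp

text \<open>
  There are at most \<open>m = 1 + q + \<dots> + q ^ (n - 1)\<close> elements of norm one, and each is a value of \<open>g y / y\<close>
  for at most \<open>q - 1\<close> elements \<open>y\<close>. As \<open>(q - 1) * m = q ^ n - 1\<close> is the number of all \<open>y \<noteq> 0\<close>, equality holds
  throughout: the ratios run evenly through all elements of norm one. These form a group of order \<open>m\<close>,
  on which \<open>z ^ d\<close> with \<open>0 < d < m\<close> is not constantly \<open>1\<close>, so its sum vanishes.
\<close>

lemma power_sums_vanish:
  fixes g :: "'a \<Rightarrow> 'a"
  assumes norm: "\<And>y. y \<noteq> 0 \<Longrightarrow> (g y / y) ^ (\<Sum>i<n. q ^ i) = 1"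
    and fibres: "\<And>z. card {y. y \<noteq> 0 \<and> g y = z * y} \<le> q - 1"
    and d: "0 < d" "d < (\<Sum>i<n. q ^ i)"
  shows "(\<Sum>y\<in>-{0}. (g y / y) ^ d) = 0"
proof -
  define m where "m = (\<Sum>i<n. q ^ i)"
  define D where "D = {z :: 'a. z ^ m = 1}"
  define fib where "fib z = {y \<in> - {0}. g y / y = z}" for z
  have m: "(q - 1) * m = q ^ n - 1"
    unfolding m_def using geometric_nat q_ge_2 by simp
  have card_fib: "card (fib z) \<le> q - 1" for z
  proof -
    have "fib z = {y. y \<noteq> 0 \<and> g y = z * y}"
      by (auto simp: fib_def field_simps)
    then show ?thesis using fibres by simp
  qed
  have group: "(\<Sum>z\<in>D. \<Sum>y\<in>fib z. h y) = sum h (- {0})" for h :: "'a \<Rightarrow> 'b::comm_monoid_add"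
    unfolding fib_def by (rule sum.group) (use norm in \<open>auto simp: D_def m_def\<close>)
  have total: "(\<Sum>z\<in>D. card (fib z)) = (q - 1) * m"
    using group[of "\<lambda>_. 1 :: nat"] m by (simp add: card_nonzero)
  have "card D \<le> m"
    unfolding D_def by (rule card_roots_of_unity_le) (use d in \<open>simp add: m_def\<close>)
  have "(q - 1) * m \<le> (q - 1) * card D"
    using sum_mono[of D "\<lambda>z. card (fib z)" "\<lambda>_. q - 1"] card_fib total by (simp add: mult.commute)
  then have "m \<le> card D" using q_ge_2 by simp
  with \<open>card D \<le> m\<close> have card_D: "card D = m" by simp
  have fib_eq: "card (fib z) = q - 1" if "z \<in> D" for z
  proof (rule ccontr)
    assume "card (fib z) \<noteq> q - 1"
    then have "card (fib z) < q - 1" using card_fib[of z] by linarith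
    then have "(\<Sum>z\<in>D. card (fib z)) < (\<Sum>z\<in>D. q - 1)"
      using that card_fib by (intro sum_strict_mono_ex1) auto
    then show False using total card_D by (simp add: mult.commute)
  qed
  have "\<not> D \<subseteq> {z. z ^ d = 1}"
  proof
    assume "D \<subseteq> {z. z ^ d = 1}"
    then have "card D \<le> card {z :: 'a. z ^ d = 1}" by (intro card_mono) auto
    then show False
      using card_roots_of_unity_le[where ?'a = 'a, OF d(1)] card_D d(2) by (simp add: m_def)
  qed
  then obtain u where u: "u \<in> D" "u ^ d \<noteq> 1" by blast
  have "m > 0" unfolding m_def by (rule sum_q_powers_pos)
  then have "u \<noteq> 0" using u(1) by (auto simp: D_def zero_power)
  then have "bij_betw ((*) u) D D"
    by (intro bij_betw_byWitness[of _ "\<lambda>y. y / u"])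
      (use u(1) in \<open>auto simp: D_def power_mult_distrib power_divide\<close>)
  then have sum_D: "(\<Sum>z\<in>D. z ^ d) = 0"
    using sum_power_eq_0_if_invariant u by blast
  have "(\<Sum>y\<in>-{0}. (g y / y) ^ d) = (\<Sum>z\<in>D. \<Sum>y\<in>fib z. (g y / y) ^ d)"
    by (rule group[symmetric])
  also have "\<dots> = (\<Sum>z\<in>D. \<Sum>y\<in>fib z. z ^ d)"
    by (intro sum.cong) (auto simp: fib_def)
  also have "\<dots> = of_nat (q - 1) * (\<Sum>z\<in>D. z ^ d)"
    by (simp add: fib_eq sum_distrib_left)
  finally show ?thesis using sum_D by simp
qed

definition linearized :: "('a \<Rightarrow> 'a) \<Rightarrow> bool" where
  "linearized h \<longleftrightarrow> (\<exists>a. \<forall>x. h x = (\<Sum>j<n. a j * x ^ q ^ j))"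

lemma linearized_monomial: "linearized (\<lambda>x. c * x ^ q ^ i)"
proof -
  have "c * x ^ q ^ i = (\<Sum>j<n. (if j = i mod n then c else 0) * x ^ q ^ j)" for x
  proof -
    have "(\<Sum>j<n. (if j = i mod n then c else 0) * x ^ q ^ j) =
        (\<Sum>j<n. if j = i mod n then c * x ^ q ^ j else 0)"
      by (intro sum.cong) auto
    then show ?thesis using n_pos by (simp add: frobenius_mod)
  qed
  then show ?thesis
    unfolding linearized_def by (intro exI[of _ "\<lambda>j. if j = i mod n then c else 0"]) blast
qed

lemma linearized_add: "linearized (\<lambda>x. h x + h' x)" if "linearized h" "linearized h'"
proof -
  from that obtain a a' where "\<And>x. h x = (\<Sum>j<n. a j * x ^ q ^ j)" "\<And>x. h' x = (\<Sum>j<n. a' j * x ^ q ^ j)"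
    unfolding linearized_def by blast
  then have "h x + h' x = (\<Sum>j<n. (a j + a' j) * x ^ q ^ j)" for x
    by (simp add: sum.distrib distrib_right)
  then show ?thesis unfolding linearized_def by (intro exI[of _ "\<lambda>j. a j + a' j"]) blast
qed

lemma linearized_scale: "linearized (\<lambda>x. c * h x)" if "linearized h"
proof -
  from that obtain a where "\<And>x. h x = (\<Sum>j<n. a j * x ^ q ^ j)"
    unfolding linearized_def by blast
  then have "c * h x = (\<Sum>j<n. (c * a j) * x ^ q ^ j)" for x
    by (simp add: sum_distrib_left mult.assoc)
  then show ?thesis unfolding linearized_def by (intro exI[of _ "\<lambda>j. c * a j"]) blast
qed

lemma linearized_id: "linearized (\<lambda>x. x)"
  using linearized_monomial[of 1 0] by simp

lemma linearized_sum: "finite X \<Longrightarrow> (\<And>i. i \<in> X \<Longrightarrow> linearized (h i)) \<Longrightarrow> linearized (\<lambda>x. \<Sum>i\<in>X. h i x)"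
proof (induction X rule: finite_induct)
  case empty
  then show ?case using linearized_monomial[of 0 0] by simp
qed (simp add: linearized_add)

lemma linearized_compose: "linearized (\<lambda>x. h (h' x))" if h: "linearized h" and h': "linearized h'"
proof -
  from h obtain a where a: "\<And>x. h x = (\<Sum>i<n. a i * x ^ q ^ i)"
    unfolding linearized_def by blast
  from h' obtain b where b: "\<And>x. h' x = (\<Sum>j<n. b j * x ^ q ^ j)"
    unfolding linearized_def by blast
  have "h' x ^ q ^ i = (\<Sum>j<n. b j ^ q ^ i * x ^ q ^ (j + i))" for x i
    by (simp add: b frobenius_sum power_mult_distrib frobenius_frobenius)
  then show ?thesis
    unfolding a by (simp add: linearized_sum linearized_scale linearized_monomial)
qed

lemma linearized_funpow: "linearized (h ^^ k)" if "linearized h"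
proof (induction k)
  case 0
  then show ?case using linearized_id by (simp add: id_def)
next
  case (Suc k)
  then show ?case using linearized_compose[OF that Suc] by (simp add: comp_def)
qed

lemma linearized_diff: "h (x - y) = h x - h y" if "linearized h"
proof -
  from that obtain a where "\<And>x. h x = (\<Sum>j<n. a j * x ^ q ^ j)"
    unfolding linearized_def by blast
  then show ?thesis by (simp add: frobenius_diff right_diff_distrib sum_subtractf)
qed

lemma linearized_0: "h 0 = 0" if "linearized h"
  using linearized_diff[OF that, of 0 0] by simp

text \<open>
  A permutation of a finite set has finite order, so its inverse is one of its iterates.
\<close>

lemma linearized_inv: "linearized (inv h)" if "linearized h" "inj h"
proof -
  have "finite (range (\<lambda>k. h ^^ k))"
    by (rule finite_subset[OF subset_UNIV]) simp
  then have "\<not> inj (\<lambda>k. h ^^ k)"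
    using finite_imageD infinite_UNIV_nat by blast
  then obtain i j where ij: "i < j" "h ^^ i = h ^^ j"
    unfolding inj_def by (metis linorder_neqE_nat)
  have "(h ^^ (j - i - 1)) (h x) = x" for x
  proof -
    have "(h ^^ i) x = (h ^^ (i + (j - i))) x" using ij by simp
    also have "\<dots> = (h ^^ i) ((h ^^ (j - i)) x)" by (simp only: funpow_add comp_apply)
    finally have "x = (h ^^ (j - i)) x"
      using inj_fn[OF that(2), of i] by (simp add: inj_eq)
    also have "j - i = Suc (j - i - 1)" using ij by simp
    finally show ?thesis by (simp only: funpow_Suc_right comp_apply)
  qed
  moreover have "surj h" using finite_UNIV_inj_surj[OF finite that(2)] .
  ultimately have "inv h = h ^^ (j - i - 1)"
    by (metis (no_types, lifting) ext surj_f_inv_f)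
  then show ?thesis using linearized_funpow[OF that(1)] by simp
qed

text \<open>
  Substituting \<open>y = a * x + b * f x\<close> turns \<open>c * x + d * f x\<close> into a linearized map \<open>g\<close> of \<open>y\<close> with
  \<open>g y / y\<close> of norm one. Scatteredness of \<open>f\<close> bounds the fibres of this ratio, because \<open>g y = z * y\<close>
  is an equation \<open>(c - z * a) * x + (d - z * b) * f x = 0\<close> whose coefficients are not both zero.
  Therefore \<open>g\<close> is a monomial.
\<close>

theorem norm_ratio_imp_frobenius:
  assumes f: "linearized f" "scattered q f"
    and det: "a * d \<noteq> b * c"
    and nonzero: "\<And>x. x \<noteq> 0 \<Longrightarrow> a * x + b * f x \<noteq> 0"
    and norm: "\<And>x. x \<noteq> 0 \<Longrightarrow> (c * x + d * f x) ^ (\<Sum>i<n. q ^ i) = (a * x + b * f x) ^ (\<Sum>i<n. q ^ i)"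
  obtains C j where "C \<noteq> 0" "j < n" "\<And>x. c * x + d * f x = C * (a * x + b * f x) ^ q ^ j"
proof -
  define M where "M = (\<lambda>x. a * x + b * f x)"
  define G where "G = (\<lambda>x. c * x + d * f x)"
  define g where "g = (\<lambda>y. G (inv M y))"
  have lin: "linearized M" "linearized G"
    unfolding M_def G_def by (intro linearized_add linearized_scale linearized_id f)+
  have "inj M"
  proof (rule injI)
    fix x y assume "M x = M y"
    then have "M (x - y) = 0" by (simp add: linearized_diff lin)
    then show "x = y" using nonzero[of "x - y"] by (auto simp: M_def)
  qed
  then have "bij M" using finite_UNIV_inj_surj[OF finite] by (simp add: bij_def)
  have "linearized g"
    unfolding g_def by (rule linearized_compose[OF lin(2) linearized_inv[OF lin(1) \<open>inj M\<close>]])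
  then obtain e where e: "\<And>y. g y = (\<Sum>j<n. e j * y ^ q ^ j)"
    unfolding linearized_def by blast
  have M_inv: "M (inv M y) = y" for y
    using \<open>bij M\<close> by (simp add: bij_is_surj surj_f_inv_f)
  have inv_M: "inv M (M x) = x" for x
    using \<open>inj M\<close> by simp
  have norm': "G x ^ (\<Sum>i<n. q ^ i) = M x ^ (\<Sum>i<n. q ^ i)" if "x \<noteq> 0" for x
    unfolding G_def M_def by (rule norm[OF that])
  have ratio: "(g y / y) ^ (\<Sum>i<n. q ^ i) = 1" if "y \<noteq> 0" for y
  proof -
    have "inv M y \<noteq> 0"
      using that M_inv[of y] linearized_0[OF lin(1)] by auto
    then have "g y ^ (\<Sum>i<n. q ^ i) = M (inv M y) ^ (\<Sum>i<n. q ^ i)"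
      unfolding g_def by (rule norm')
    then have "g y ^ (\<Sum>i<n. q ^ i) = y ^ (\<Sum>i<n. q ^ i)"
      by (simp only: M_inv)
    then show ?thesis
      using that by (simp only: power_divide) simp
  qed
  have fibres: "card {y. y \<noteq> 0 \<and> g y = z * y} \<le> q - 1" for z
  proof -
    let ?S = "{x. x \<noteq> 0 \<and> (c - z * a) * x + (d - z * b) * f x = 0}"
    have "{y. y \<noteq> 0 \<and> g y = z * y} \<subseteq> M ` ?S"
    proof
      fix y assume "y \<in> {y. y \<noteq> 0 \<and> g y = z * y}"
      then have y: "y \<noteq> 0" "G (inv M y) = z * M (inv M y)" by (auto simp: g_def M_inv)
      have "inv M y \<noteq> 0" using y M_inv[of y] linearized_0[OF lin(1)] by auto
      moreover have key: "(c - z * a) * x + (d - z * b) * f x = G x - z * M x" for x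
        by (simp add: G_def M_def algebra_simps)
      ultimately have "inv M y \<in> ?S"
        by (simp only: mem_Collect_eq key y(2) diff_self not_False_eq_True simp_thms)
      then have "M (inv M y) \<in> M ` ?S" by (rule imageI)
      then show "y \<in> M ` ?S" by (simp only: M_inv)
    qed
    then have "card {y. y \<noteq> 0 \<and> g y = z * y} \<le> card ?S"
      by (rule surj_card_le[OF finite])
    also have "\<dots> \<le> q - 1"
    proof (cases "d = z * b")
      case True
      then have "c - z * a \<noteq> 0" using det by auto
      then have "?S = {}" using True by auto
      then show ?thesis by (simp only: card.empty le0)
    next
      case False
      let ?T = "{x. f x + ((c - z * a) / (d - z * b)) * x = 0}"
      have "(c - z * a) * x + (d - z * b) * f x =
          (d - z * b) * (f x + ((c - z * a) / (d - z * b)) * x)" for x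
        using False by (simp add: distrib_left)
      then have "?S = ?T - {0}"
        using False by auto
      moreover have "0 \<in> ?T" using linearized_0[OF f(1)] by simp
      ultimately have "card ?S = card ?T - 1" by (simp add: card_Diff_singleton)
      also have "\<dots> \<le> q - 1"
        using f(2) unfolding scattered_def by (intro diff_le_mono) blast
      finally show ?thesis .
    qed
    finally show ?thesis .
  qed
  have "g 1 \<noteq> 0"
  proof
    assume "g 1 = 0"
    then have "(0 :: 'a) ^ (\<Sum>i<n. q ^ i) = 1"
      using ratio[of 1] by (simp only: div_0 one_neq_zero not_False_eq_True)
    then show False
      by (simp only: zero_power[OF sum_q_powers_pos] zero_neq_one)
  qed
  obtain C j where C: "C \<noteq> 0" "j < n" "\<And>y. g y = C * y ^ q ^ j"
  proof (rule linearized_monomial_if_power_sums_vanish[OF e])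
    show "\<exists>y. g y \<noteq> 0" using \<open>g 1 \<noteq> 0\<close> by blast
    show "(\<Sum>y\<in>-{0}. (g y / y) ^ d) = 0" if "0 < d" "d < (\<Sum>i<n. q ^ i)" for d
      by (rule power_sums_vanish[OF ratio fibres that])
  qed (rule that)
  have "G x = C * M x ^ q ^ j" for x
    using C(3)[of "M x"] by (simp add: g_def inv_M)
  then show thesis using that C by (simp add: G_def M_def)
qed

end

section \<open>Linear sets of pseudoregulus type\<close>

text \<open>
  The matrix of the collineation, pulled back along the inverse of its field automorphism, sends
  \<open>(x, f x)\<close> to a multiple of some \<open>(y, y ^ q ^ s)\<close>. The last property states this proportionality
  as an equation between cross products, without the scalar factor.
\<close>

lemma pseudoregulus_typeE:
  fixes f :: "'a::field \<Rightarrow> 'a"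
  assumes "pseudoregulus_type q n (linear_set f)"
  obtains a b c d s where "a * d \<noteq> b * c"
    "\<And>x. x \<noteq> 0 \<Longrightarrow> a * x + b * f x \<noteq> 0"
    "\<And>x. x \<noteq> 0 \<Longrightarrow> \<exists>y. (c * x + d * f x) * y = (a * x + b * f x) * y ^ q ^ s \<and> y \<noteq> 0"
proof -
  obtain s \<phi> where s: "\<phi> \<in> PGammaL2" "(`) (\<phi>) (linear_set f) = linear_set (\<lambda>x. x ^ (q ^ s))"
    using assms unfolding pseudoregulus_type_def PGammaL_equivalent_def by blast
  then obtain A \<sigma> where A: "invertible A" and \<sigma>: "field_automorphism \<sigma>"
    and \<phi>: "\<phi> = (\<lambda>P. (\<lambda>v. A *v (\<chi> i. \<sigma> (v $ i))) ` P)"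
    unfolding PGammaL2_def GammaL2_def by blast
  have bij: "bij \<sigma>" and add: "\<sigma> (x + y) = \<sigma> x + \<sigma> y" and mult: "\<sigma> (x * y) = \<sigma> x * \<sigma> y"
    and one: "\<sigma> 1 = 1" for x y
    using \<sigma> unfolding field_automorphism_def by blast+
  have inj: "\<sigma> x = \<sigma> y \<longleftrightarrow> x = y" for x y
    using bij by (meson bij_is_inj inj_eq)
  have "\<sigma> 0 + \<sigma> 0 = \<sigma> 0 + 0"
    using add[of 0 0] by (metis add_0_right)
  then have zero: "\<sigma> 0 = 0" by (simp only: add_left_cancel)
  have pow: "\<sigma> (x ^ i) = \<sigma> x ^ i" for x i by (induction i) (simp_all add: one mult)
  define \<tau> where "\<tau> = inv \<sigma>"
  have \<sigma>\<tau>: "\<sigma> (\<tau> x) = x" for x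
    unfolding \<tau>_def using bij by (simp add: bij_is_surj surj_f_inv_f)
  have det: "A$1$1 * A$2$2 \<noteq> A$1$2 * A$2$1"
    using A by (auto simp: invertible_det_nz det_2)
  have point: "\<exists>k y. k \<noteq> 0 \<and> y \<noteq> 0 \<and> A$1$1 * \<sigma> x + A$1$2 * \<sigma> (f x) = k * y \<and>
      A$2$1 * \<sigma> x + A$2$2 * \<sigma> (f x) = k * y ^ q ^ s" if "x \<noteq> 0" for x
  proof -
    have "\<phi> (vec.span {vector [x, f x]}) \<in> linear_set (\<lambda>x. x ^ (q ^ s))"
      using s(2) that unfolding linear_set_def by blast
    then obtain y where y: "y \<noteq> 0" "\<phi> (vec.span {vector [x, f x]}) = vec.span {vector [y, y ^ q ^ s]}"
      unfolding linear_set_def by blast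
    have "vector [x, f x] \<in> vec.span {vector [x, f x] :: 'a^2}"
      by (simp add: vec.span_base)
    then have "A *v (\<chi> i. \<sigma> ((vector [x, f x] :: 'a^2) $ i)) \<in> vec.span {vector [y, y ^ q ^ s]}"
      using y(2) unfolding \<phi> by blast
    then obtain k where k: "A *v (\<chi> i. \<sigma> ((vector [x, f x] :: 'a^2) $ i)) = k *s vector [y, y ^ q ^ s]"
      by (auto simp: vec.span_singleton)
    have eq: "A$1$1 * \<sigma> x + A$1$2 * \<sigma> (f x) = k * y" "A$2$1 * \<sigma> x + A$2$2 * \<sigma> (f x) = k * y ^ q ^ s"
      using arg_cong[OF k, of "\<lambda>v. v $ 1"] arg_cong[OF k, of "\<lambda>v. v $ 2"]
      by (simp_all add: matrix_vector_mult_def sum_2)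
    have "k \<noteq> 0"
    proof
      assume "k = 0"
      then have "A$2$2 * (A$1$1 * \<sigma> x + A$1$2 * \<sigma> (f x)) - A$1$2 * (A$2$1 * \<sigma> x + A$2$2 * \<sigma> (f x)) = 0"
        using eq by simp
      then have "(A$1$1 * A$2$2 - A$1$2 * A$2$1) * \<sigma> x = 0"
        by (simp add: algebra_simps)
      then have "\<sigma> x = \<sigma> 0" using det zero by simp
      then show False using that inj by blast
    qed
    with y(1) eq show ?thesis by blast
  qed
  show thesis
  proof (rule that[of "\<tau> (A$1$1)" "\<tau> (A$2$2)" "\<tau> (A$1$2)" "\<tau> (A$2$1)" s])
    show "\<tau> (A$1$1) * \<tau> (A$2$2) \<noteq> \<tau> (A$1$2) * \<tau> (A$2$1)"
      using det by (metis mult \<sigma>\<tau>)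
    fix x :: 'a assume "x \<noteq> 0"
    then obtain k y where k: "k \<noteq> 0" "y \<noteq> 0" "A$1$1 * \<sigma> x + A$1$2 * \<sigma> (f x) = k * y"
      "A$2$1 * \<sigma> x + A$2$2 * \<sigma> (f x) = k * y ^ q ^ s"
      using point by blast
    have M: "\<sigma> (\<tau> (A$1$1) * x + \<tau> (A$1$2) * f x) = k * y"
      and G: "\<sigma> (\<tau> (A$2$1) * x + \<tau> (A$2$2) * f x) = k * y ^ q ^ s"
      by (simp_all add: add mult \<sigma>\<tau> k)
    show "\<tau> (A$1$1) * x + \<tau> (A$1$2) * f x \<noteq> 0"
      using M k zero by (metis mult_eq_0_iff)
    have "\<sigma> ((\<tau> (A$2$1) * x + \<tau> (A$2$2) * f x) * \<tau> y) =
        \<sigma> ((\<tau> (A$1$1) * x + \<tau> (A$1$2) * f x) * \<tau> y ^ q ^ s)"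
      by (simp only: mult M G pow \<sigma>\<tau>) (simp add: mult_ac)
    then have "(\<tau> (A$2$1) * x + \<tau> (A$2$2) * f x) * \<tau> y =
        (\<tau> (A$1$1) * x + \<tau> (A$1$2) * f x) * \<tau> y ^ q ^ s" by (simp only: inj)
    moreover have "\<tau> y \<noteq> 0" using k(2) \<sigma>\<tau> zero by metis
    ultimately show "\<exists>y. (\<tau> (A$2$1) * x + \<tau> (A$2$2) * f x) * y =
        (\<tau> (A$1$1) * x + \<tau> (A$1$2) * f x) * y ^ q ^ s \<and> y \<noteq> 0" by blast
  qed
qed

context galois_field
begin

section \<open>Comparing coefficients on the eigenspaces of \<open>x ^ q ^ t\<close>\<close>

lemma q_power_inj: "q ^ i = q ^ j \<longleftrightarrow> i = j"
  using q_ge_2 by (intro power_inject_exp) simp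

text \<open>
  Both sides are polynomials of degree less than \<open>q ^ t\<close>. The exponents on one side may coincide,
  hence the coefficients are written as sums of conditionals.
\<close>

lemma two_term_coefficients:
  fixes c d A B :: 'a
  assumes S: "q ^ t \<le> card S" and less: "i < t" "e < t" "j < t" "l < t"
    and eq: "\<And>x. x \<in> S \<Longrightarrow> c * x ^ q ^ i + d * x ^ q ^ e = A * x ^ q ^ j + B * x ^ q ^ l"
  shows "(if k = i then c else 0) + (if k = e then d else 0) = (if k = j then A else 0) + (if k = l then B else 0)"
proof -
  let ?P = "monom c (q ^ i) + monom d (q ^ e)" and ?R = "monom A (q ^ j) + monom B (q ^ l)"
  have deg: "degree (monom u (q ^ i) + monom v (q ^ e)) < q ^ t" if "i < t" "e < t" for i e and u v :: 'a
  proof -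
    have "q ^ i < q ^ t" "q ^ e < q ^ t"
      using that q_ge_2 by simp_all
    then show ?thesis
      by (intro degree_add_less) (auto intro: le_less_trans[OF degree_monom_le])
  qed
  have "?P = ?R"
  proof (rule poly_eqI_degree[of S])
    show "degree ?P < card S" "degree ?R < card S"
      using deg[OF less(1,2)] deg[OF less(3,4)] S by (meson less_le_trans)+
  qed (use eq in \<open>simp add: poly_monom\<close>)
  then have "poly.coeff ?P (q ^ k) = poly.coeff ?R (q ^ k)" by simp
  then show ?thesis by (simp add: q_power_inj eq_commute)
qed

lemma sign_frobenius: "\<eta> ^ q ^ i = \<eta>" if "\<eta> \<in> {1, - 1 :: 'a}"
  using that by (auto simp: frobenius_minus)

lemma eigenspace_frobenius: "(x ^ q ^ i) ^ q ^ t = \<eta> * x ^ q ^ i"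
  if "\<eta> \<in> {1, - 1 :: 'a}" "x ^ q ^ t = \<eta> * x"
proof -
  have "(x ^ q ^ i) ^ q ^ t = (x ^ q ^ t) ^ q ^ i"
    by (simp add: frobenius_frobenius add.commute)
  then show ?thesis using that by (simp add: power_mult_distrib sign_frobenius)
qed

text \<open>
  On an eigenspace of \<open>x ^ q ^ t\<close> exponents can be reduced modulo \<open>t\<close>, at the cost of a sign.
\<close>

lemma eigenspace_mod: "x ^ q ^ e = \<eta> ^ (e div t) * x ^ q ^ (e mod t)"
  if \<eta>: "\<eta> \<in> {1, - 1 :: 'a}" and x: "x ^ q ^ t = \<eta> * x"
proof -
  have "y ^ q ^ (t * l) = \<eta> ^ l * y" if "y ^ q ^ t = \<eta> * y" for l y
  proof (induction l)
    case (Suc l)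
    have "y ^ q ^ (t * Suc l) = (y ^ q ^ (t * l)) ^ q ^ t"
      by (simp add: frobenius_frobenius add.commute)
    also have "\<dots> = (\<eta> ^ l) ^ q ^ t * y ^ q ^ t"
      by (simp add: Suc power_mult_distrib)
    also have "(\<eta> ^ l) ^ q ^ t = (\<eta> ^ q ^ t) ^ l"
      by (simp add: mult.commute flip: power_mult)
    also have "\<dots> = \<eta> ^ l"
      using \<eta> by (simp only: sign_frobenius)
    finally show ?case using that by (simp add: mult_ac)
  qed simp
  from this[OF eigenspace_frobenius[OF \<eta> x], of "e mod t" "e div t"]
  have "(x ^ q ^ (e mod t)) ^ q ^ (t * (e div t)) = \<eta> ^ (e div t) * x ^ q ^ (e mod t)" .
  then show ?thesis by (simp only: frobenius_frobenius mod_mult_div_eq)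
qed

text \<open>
  On the eigenspace \<open>f\<close> is a power of Frobenius. After reduction modulo \<open>t\<close>, the two sides of the equation have
  exponents \<open>0, e\<close> and \<open>j, e + j\<close>. If \<open>j\<close> vanishes modulo \<open>t\<close>, the exponents match termwise. Otherwise
  \<open>e + j\<close> can only match \<open>0\<close>, and \<open>j\<close> can only match \<open>e\<close>, unless the terms vanish.
\<close>

lemma eigenspace_comparison:
  fixes f :: "'a \<Rightarrow> 'a"
  assumes \<eta>: "\<eta> \<in> {1, - 1}" and large: "q ^ t \<le> card {x :: 'a. x ^ q ^ t = \<eta> * x}"
    and f: "\<And>x. x ^ q ^ t = \<eta> * x \<Longrightarrow> f x = x ^ q ^ e" and e: "\<not> t dvd e" and "t > 0"
    and C: "C \<noteq> 0"
    and eq: "\<And>x. x ^ q ^ t = \<eta> * x \<Longrightarrow> c * x + d * f x = C * (a * x + b * f x) ^ q ^ j"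
  shows "t dvd j \<Longrightarrow> c = \<eta> ^ (j div t) * C * a ^ q ^ j \<and> d = \<eta> ^ (j div t) * C * b ^ q ^ j"
    and "\<not> t dvd j \<Longrightarrow> b \<noteq> 0 \<Longrightarrow> t dvd e + j"
    and "\<not> t dvd j \<Longrightarrow> b = 0 \<Longrightarrow> a \<noteq> 0 \<Longrightarrow> e mod t = j mod t"
proof -
  define A where "A = C * a ^ q ^ j * \<eta> ^ (j div t)"
  define B where "B = C * b ^ q ^ j * \<eta> ^ ((e + j) div t)"
  define d' where "d' = d * \<eta> ^ (e div t)"
  have "\<eta> \<noteq> 0" using \<eta> by auto
  then have \<eta>0: "\<eta> ^ i \<noteq> 0" for i by (rule power_not_zero)
  have "c * x ^ q ^ 0 + d' * x ^ q ^ (e mod t) = A * x ^ q ^ (j mod t) + B * x ^ q ^ ((e + j) mod t)"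
    if x: "x \<in> {x. x ^ q ^ t = \<eta> * x}" for x
  proof -
    have red: "x ^ q ^ i = \<eta> ^ (i div t) * x ^ q ^ (i mod t)" for i
      by (rule eigenspace_mod[OF \<eta>]) (use x in simp)
    have "c * x + d * x ^ q ^ e = C * (a * x + b * x ^ q ^ e) ^ q ^ j"
      using eq[of x] f[of x] x by simp
    also have "\<dots> = C * (a ^ q ^ j * x ^ q ^ j + b ^ q ^ j * x ^ q ^ (e + j))"
      by (simp add: frobenius_add power_mult_distrib frobenius_frobenius)
    finally show ?thesis
      by (simp only: red[of e] red[of j] red[of "e + j"]) (simp add: A_def B_def d'_def algebra_simps)
  qed
  from two_term_coefficients[OF large _ _ _ _ this] \<open>t > 0\<close>
  have cmp: "(if k = 0 then c else 0) + (if k = e mod t then d' else 0) =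
      (if k = j mod t then A else 0) + (if k = (e + j) mod t then B else 0)" for k
    by simp
  have e0: "e mod t \<noteq> 0" using e by (simp add: dvd_eq_mod_eq_0)
  have ej: "(e + j) mod t = e mod t \<longleftrightarrow> t dvd j" "(e + j) mod t = j mod t \<longleftrightarrow> t dvd e"
    using cong_add_lcancel_0_nat[of e j t] cong_add_rcancel_0_nat[of e j t]
    by (simp_all add: cong_def dvd_eq_mod_eq_0)
  {
    assume j: "t dvd j"
    then have j0: "j mod t = 0" by simp
    have "c = A" using cmp[of 0] ej e0 j j0 by simp
    have "d' = B" using cmp[of "e mod t"] ej e0 j j0 by simp
    moreover have "(e + j) div t = e div t + j div t"
      using j by (rule div_plus_div_distrib_dvd_right)
    ultimately have "d = \<eta> ^ (j div t) * C * b ^ q ^ j"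
      using \<open>\<eta> \<noteq> 0\<close> by (simp add: B_def d'_def power_add mult_ac)
    with \<open>c = A\<close> show "c = \<eta> ^ (j div t) * C * a ^ q ^ j \<and> d = \<eta> ^ (j div t) * C * b ^ q ^ j"
      by (simp add: A_def)
  }
  {
    assume j: "\<not> t dvd j" and b: "b \<noteq> 0"
    then have "B \<noteq> 0" using C \<eta>0 by (simp add: B_def)
    then have "(e + j) mod t = 0"
      using cmp[of "(e + j) mod t"] ej e j by (auto split: if_splits)
    then show "t dvd e + j" by (simp add: dvd_eq_mod_eq_0)
  }
  {
    assume j: "\<not> t dvd j" and ab: "b = 0" "a \<noteq> 0"
    then have "A \<noteq> 0" using C \<eta>0 by (simp add: A_def)
    moreover have "j mod t \<noteq> 0" using j by (simp add: dvd_eq_mod_eq_0)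
    ultimately show "e mod t = j mod t"
      using cmp[of "j mod t"] ej e by (auto split: if_splits)
  }
qed

lemma card_eigenspace_le: "card {x :: 'a. x ^ q ^ t = \<eta> * x} \<le> q ^ t" if "t > 0"
proof -
  let ?p = "monom 1 (q ^ t) - monom \<eta> 1 :: 'a poly"
  have gt: "q ^ t > 1" using that q_ge_2 by (metis One_nat_def Suc_1 Suc_le_lessD one_less_power)
  then have "poly.coeff ?p (q ^ t) = 1" by simp
  then have "?p \<noteq> 0" by (metis coeff_0 zero_neq_one)
  moreover have "degree ?p \<le> q ^ t"
    using gt by (intro degree_diff_le order.trans[OF degree_monom_le]) auto
  moreover have "{x :: 'a. x ^ q ^ t = \<eta> * x} = {x. poly ?p x = 0}"
    by (simp add: poly_monom)
  ultimately show ?thesis using card_poly_roots_bound[of ?p] by simp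
qed

lemma two_nonzero: "(2 :: 'a) \<noteq> 0" if "odd q"
proof
  assume "(2 :: 'a) = 0"
  then have "CHAR('a) dvd 2" by (metis of_nat_eq_0_iff_char_dvd of_nat_numeral)
  then have "CHAR('a) = 2" using prime_CHAR primes_dvd_imp_eq two_is_prime_nat by blast
  then have "2 dvd q ^ n" using CHAR_dvd_card by simp
  then show False using that by simp
qed

lemma eq_neg_self: "x = 0" if "odd q" "x = - x" for x :: 'a
proof -
  have "2 * x = x + x" by (rule mult_2)
  also have "\<dots> = x + - x" by (subst (2) that(2)) (rule refl)
  finally show ?thesis using two_nonzero[OF that(1)] by simp
qed

text \<open>
  Every \<open>x\<close> is half the sum of \<open>x + x ^ q ^ t\<close> and \<open>x - x ^ q ^ t\<close>, which lie in the two eigenspaces. Since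
  neither can have more than \<open>q ^ t\<close> elements, both must have that many.
\<close>

lemma eigenspaces_large:
  assumes n: "n = 2 * t" and "odd q" and "\<eta> \<in> {1, - 1 :: 'a}"
  shows "q ^ t \<le> card {x :: 'a. x ^ q ^ t = \<eta> * x}"
proof -
  let ?K = "{x :: 'a. x ^ q ^ t = 1 * x}" and ?W = "{x :: 'a. x ^ q ^ t = - 1 * x}"
  have t: "t > 0" using n n_pos by simp
  have twice: "(x ^ q ^ t) ^ q ^ t = x" for x :: 'a
    using power_card[of x] n by (simp add: frobenius_frobenius mult_2)
  have "x \<in> (\<lambda>(u, w). (u + w) / 2) ` (?K \<times> ?W)" for x :: 'a
  proof (rule image_eqI)
    show "x = (case (x + x ^ q ^ t, x - x ^ q ^ t) of (u, w) \<Rightarrow> (u + w) / 2)"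
      using two_nonzero[OF \<open>odd q\<close>] by simp
    show "(x + x ^ q ^ t, x - x ^ q ^ t) \<in> ?K \<times> ?W"
      by (simp add: frobenius_add frobenius_diff twice add.commute)
  qed
  then have "UNIV \<subseteq> (\<lambda>(u, w). (u + w) / 2) ` (?K \<times> ?W)" by blast
  then have "CARD('a) \<le> card (?K \<times> ?W)"
    by (rule surj_card_le[rotated]) simp
  then have prod: "q ^ t * q ^ t \<le> card ?K * card ?W"
    by (simp only: card_field n card_cartesian_product mult_2 power_add)
  have pos: "q ^ t > 0" using q_ge_2 by simp
  have "q ^ t * q ^ t \<le> card ?K * q ^ t" "q ^ t * q ^ t \<le> q ^ t * card ?W"
    using prod card_eigenspace_le[OF t, of 1] card_eigenspace_le[OF t, of "- 1"]
    by (meson mult_le_mono2 mult_le_mono1 order.trans)+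
  with pos have "q ^ t \<le> card ?K" "q ^ t \<le> card ?W" by simp_all
  then show ?thesis using assms(3) by (elim insertE) auto
qed

section \<open>The iterates of \<open>psi\<close>\<close>

lemma psi_eq: "psi q t x = 1 / 2 * (x ^ q + x ^ q ^ (t - 1) - x ^ q ^ (t + 1) + x ^ q ^ (2 * t - 1))"
  for x :: 'a
  unfolding psi_def psi_poly_def by (simp add: poly_monom)

lemma linearized_psi: "linearized (psi q t)"
proof -
  have "psi q t x = 1 / 2 * x ^ q ^ 1 + (1 / 2 * x ^ q ^ (t - 1) + (- 1 / 2 * x ^ q ^ (t + 1) + 1 / 2 * x ^ q ^ (2 * t - 1)))"
    for x :: 'a
    by (simp add: psi_eq algebra_simps diff_divide_distrib add_divide_distrib)
  then have "psi q t = (\<lambda>x :: 'a. 1 / 2 * x ^ q ^ 1 + (1 / 2 * x ^ q ^ (t - 1) + (- 1 / 2 * x ^ q ^ (t + 1) + 1 / 2 * x ^ q ^ (2 * t - 1))))"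
    by blast
  then show ?thesis by (simp only:) (intro linearized_add linearized_monomial)
qed

text \<open>
  Writing \<open>F\<close> for the Frobenius power \<open>q\<close>, the map is
  \<open>(F * (1 - F ^ t) + F ^ (t - 1) * (1 + F ^ t)) / 2\<close>, and \<open>1 - F ^ t\<close> and \<open>1 + F ^ t\<close> act on the eigenspaces as \<open>0\<close> and
  \<open>2\<close> in one or the other order.
\<close>

lemma psi_eigenspace:
  assumes "odd q" and t: "t > 0" and x: "(x :: 'a) ^ q ^ t = \<eta> * x" and \<eta>: "\<eta> \<in> {1, - 1}"
  shows "psi q t x = x ^ q ^ (if \<eta> = 1 then t - 1 else 1)"
proof -
  have "x ^ q ^ (t + 1) = \<eta> * x ^ q ^ 1"
    using x \<eta> frobenius_frobenius[of x t 1] by (simp add: power_mult_distrib sign_frobenius[of _ 1, simplified])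
  moreover have "x ^ q ^ (2 * t - 1) = \<eta> * x ^ q ^ (t - 1)"
  proof -
    have "2 * t - 1 = t + (t - 1)" using t by simp
    then have "x ^ q ^ (2 * t - 1) = (x ^ q ^ t) ^ q ^ (t - 1)" by (simp only: frobenius_frobenius)
    then show ?thesis using x \<eta> by (simp add: power_mult_distrib sign_frobenius)
  qed
  moreover have "(1 :: 'a) \<noteq> - 1"
    using two_nonzero[OF \<open>odd q\<close>] by (metis add.right_inverse one_add_one)
  ultimately show ?thesis
    using \<eta> two_nonzero[OF \<open>odd q\<close>] by (auto simp: psi_eq field_simps)
qed

lemma psi_funpow_eigenspace:
  assumes "odd q" and t: "t > 0" and x: "(x :: 'a) ^ q ^ t = \<eta> * x" and \<eta>: "\<eta> \<in> {1, - 1}"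
  shows "(psi q t ^^ k) x = x ^ q ^ ((if \<eta> = 1 then t - 1 else 1) * k)"
proof (induction k)
  case (Suc k)
  let ?e = "if \<eta> = 1 then t - 1 else 1"
  have "(psi q t ^^ Suc k) x = psi q t (x ^ q ^ (?e * k))"
    by (simp only: funpow.simps comp_apply Suc)
  also have "\<dots> = (x ^ q ^ (?e * k)) ^ q ^ ?e"
    by (rule psi_eigenspace[OF assms(1) t _ \<eta>]) (rule eigenspace_frobenius[OF \<eta> x])
  finally show ?case by (simp only: frobenius_frobenius mult_Suc_right add.commute)
qed simp

text \<open>
  On the two eigenspaces \<open>f\<close> is the Frobenius power with exponent \<open>(t - 1) * k\<close> and \<open>k\<close>, respectively. These
  are nonzero and distinct modulo \<open>t\<close>, as \<open>k\<close> is coprime to \<open>t\<close> and \<open>t \<ge> 3\<close>. If \<open>t\<close> does not divide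
  \<open>j\<close>, then \<open>j\<close> or \<open>- j\<close> would be congruent to both of them. If \<open>j = 0\<close>, then \<open>(c, d)\<close> is a multiple of
  \<open>(a, b)\<close>. If \<open>j = t\<close>, the two eigenspaces determine \<open>c\<close> and \<open>d\<close> with opposite signs, so both are zero.
\<close>

lemma psi_funpow_not_frobenius_related:
  fixes a b c d C :: 'a
  assumes "odd q" and n: "n = 2 * t" and t: "t \<ge> 3" and k: "coprime n k"
    and f: "f = psi q t ^^ k"
    and C: "C \<noteq> 0" and j: "j < n"
    and eq: "\<And>x. c * x + d * f x = C * (a * x + b * f x) ^ q ^ j"
  shows "a * d = b * c"
proof (rule ccontr)
  assume det: "a * d \<noteq> b * c"
  have t0: "t > 0" using t by simp
  have tk: "coprime t k" using k n by simp
  have neg1: "(1 :: 'a) \<noteq> - 1"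
    using two_nonzero[OF \<open>odd q\<close>] by (metis add.right_inverse one_add_one)
  have e1: "\<not> t dvd (t - 1) * k" and e2: "\<not> t dvd k"
    using tk t by (simp_all add: coprime_dvd_mult_left_iff) (auto dest: dvd_imp_le coprime_common_divisor_nat)
  have K: "\<And>x :: 'a. x ^ q ^ t = 1 * x \<Longrightarrow> f x = x ^ q ^ ((t - 1) * k)"
    and W: "\<And>x :: 'a. x ^ q ^ t = - 1 * x \<Longrightarrow> f x = x ^ q ^ k"
    unfolding f using psi_funpow_eigenspace[OF \<open>odd q\<close> t0] neg1 by fastforce+
  note cmpK = eigenspace_comparison[OF _ eigenspaces_large[OF n \<open>odd q\<close>, of 1] K e1 t0 C eq]
  note cmpW = eigenspace_comparison[OF _ eigenspaces_large[OF n \<open>odd q\<close>, of "- 1"] W e2 t0 C eq]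
  have e12: "[(t - 1) * k \<noteq> k] (mod t)"
  proof
    assume "[(t - 1) * k = k] (mod t)"
    then have "[(t - 1) * k = 1 * k] (mod t)" by (simp only: mult_1)
    moreover have "coprime k t" using tk by (simp only: coprime_commute)
    ultimately have "[t - 1 = 1] (mod t)" by (simp only: cong_mult_rcancel_nat)
    then show False using t by (simp add: cong_def)
  qed
  show False
  proof (cases "t dvd j")
    case True
    have K': "c = C * a ^ q ^ j" "d = C * b ^ q ^ j"
      using cmpK(1) True by simp_all
    have W': "c = (- 1) ^ (j div t) * C * a ^ q ^ j" "d = (- 1) ^ (j div t) * C * b ^ q ^ j"
      using cmpW(1) True by simp_all
    consider "j = 0" | "j = t" using True j n t0
      by (metis One_nat_def dvd_div_mult_self less_2_cases_iff less_mult_imp_div_less mult_0 mult_1)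
    then show False
    proof cases
      case 1
      then show False using K' det by simp
    next
      case 2
      then have "j div t = 1" using t0 by simp
      then have "c = - (C * a ^ q ^ j)" "d = - (C * b ^ q ^ j)" using W' by simp_all
      then have "c = - c" "d = - d" using K' by simp_all
      then have "c = 0" "d = 0" using eq_neg_self[OF \<open>odd q\<close>] by blast+
      then show False using det by simp
    qed
  next
    case False
    show False
    proof (cases "b = 0")
      case True
      then have "a \<noteq> 0" using det by auto
      then have "((t - 1) * k) mod t = k mod t"
        using cmpK(3) cmpW(3) False True by simp
      then show False using e12 by (simp add: cong_def)
    next
      case b: False
      have "t dvd (t - 1) * k + j" "t dvd k + j"
        using cmpK(2) cmpW(2) False b by simp_all
      then have "[(t - 1) * k + j = k + j] (mod t)"
        by (simp add: cong_def dvd_eq_mod_eq_0)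
      then show False using e12 by (simp add: cong_add_rcancel_nat)
    qed
  qed
qed

end

theorem proposition3p3:
  fixes q n t k :: nat
    and f :: "'a::{field, finite} \<Rightarrow> 'a"
  assumes "odd q" and "primepow q"
    and "n = 2 * t" and "n \<ge> 6"
    and "CARD('a) = q ^ n"
    and "k > 0" and "coprime n k"
    and "f = psi q t ^^ k"
    and "scattered q f"
  shows "\<not> pseudoregulus_type q n (linear_set f)"
proof
  interpret galois_field q n "TYPE('a)"
    using assms by unfold_locales
  assume "pseudoregulus_type q n (linear_set f)"
  then obtain a b c d s where det: "a * d \<noteq> b * c"
    and nz: "\<And>x. x \<noteq> 0 \<Longrightarrow> a * x + b * f x \<noteq> 0"
    and point: "\<And>x. x \<noteq> 0 \<Longrightarrow> \<exists>y. (c * x + d * f x) * y = (a * x + b * f x) * y ^ q ^ s \<and> y \<noteq> 0"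
    by (rule pseudoregulus_typeE) blast
  have lin: "linearized f"
    using assms linearized_funpow[OF linearized_psi] by simp
  have norm: "(c * x + d * f x) ^ (\<Sum>i<n. q ^ i) = (a * x + b * f x) ^ (\<Sum>i<n. q ^ i)" if "x \<noteq> 0" for x
  proof -
    from point[OF that] obtain y where y: "y \<noteq> 0" "(c * x + d * f x) * y = (a * x + b * f x) * y ^ q ^ s" by blast
    from arg_cong[OF y(2), of "\<lambda>z. z ^ (\<Sum>i<n. q ^ i)"] y(1) show ?thesis
      by (simp add: power_mult_distrib norm_frobenius)
  qed
  obtain C j where "C \<noteq> 0" "j < n" "\<And>x. c * x + d * f x = C * (a * x + b * f x) ^ q ^ j"
    using norm_ratio_imp_frobenius[OF lin \<open>scattered q f\<close> det nz norm] by blast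
  then show False
    using psi_funpow_not_frobenius_related[of t k f C j c d a b] assms det by auto
qed

end
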